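(* Let $S=S_{g,n}$ with $\xi(S)=3g+n-3>1$, and let $V$ be the constant, depending only on $S$, with property $(\ast)$ stated in the context. Let $x,y\in C(S)$ and let $g_{x,y}=\{v_i\}$ be a geodesic in $C(S)$ between $x$ and $y$ such that $d_S(x,v_i)=i$ for all $i$. Then, except for at most $3$ consecutive vertices $v_p$ of $g_{x,y}$, we have $$i(x,y)\leq \big(i(x,v_p)\cdot i(v_p,y)\big)^{2V}.$$ (As in $(\ast)$, we let $i(x,v_1)=1$ and $i(v_{d_S(x,y)-1},y)=1$ on the right-hand side.)
   Context: $S_{g,n}$ is a compact surface of genus $g$ with $n$ boundary components, and $\xi(S_{g,n})=3g+n-3$. Curves are simple, closed, essential, not isotopic to $\partial S$, and considered up to free isotopy. For $\xi(S)>1$ the curve graph $C(S)$ has isotopy classes of curves as vertices, with an edge between two vertices that can be realized disjointly; $d_S$ is the graph metric in which each edge has length $1$. $x\in C(S)$ means that $x$ is a vertex. $i(x,y)$ is the minimal possible number of intersections between $x$ and $y$ up to isotopy. The geodesic is not required to be tight. Property $(\ast)$ of $V$ (a theorem of the paper gives such a $V$ depending only on $S$): for all $x,y\in C(S)$ and every geodesic $g_{x,y}=\{v_i\}$ between $x$ and $y$ such that $d_S(x,v_i)=i$ for all $i$, one has $$i(x,y)\leq \big(i(x,v_p)\cdot i(v_p,y)\cdot i(x,v_q)\cdot i(v_q,y)\big)^{V}$$ for all $p,q$ such that $|p-q|>2$, where one lets $i(x,v_1)=1$ and $i(v_{d_S(x,y)-1},y)=1$ (even though these intersection numbers are $0$).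 The paper remarks that the length of $g_{x,y}$ needs to be at least $5$ in this property. *)

theory Defs
  imports "HOL-Analysis.Analysis" "HOL-Homology.Homology" "Graph_Theory.Graph_Theory"
begin

definition surface_interior :: "'a topology \<Rightarrow> 'a set" where
  "surface_interior X =
     {x \<in> topspace X. \<exists>U W. openin X U \<and> x \<in> U \<and> open (W :: complex set) \<and>
        subtopology X U homeomorphic_space top_of_set W}"

definition surface_boundary :: "'a topology \<Rightarrow> 'a set" where
  "surface_boundary X = topspace X - surface_interior X"

definition boundary_components :: "'a topology \<Rightarrow> 'a set set" where
  "boundary_components X = connected_components_of (subtopology X (surface_boundary X))"

definition surface :: "'a topology \<Rightarrow> bool" where
  "surface X \<longleftrightarrow> Hausdorff_space X \<and> second_countable X \<and>
     (\<forall>x \<in> topspace X. \<exists>U W. openin X U \<and> x \<in> U \<and>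
        openin (top_of_set {z :: complex. 0 \<le> Im z}) W \<and>
        subtopology X U homeomorphic_space top_of_set W)"

text \<open>
  An orientation is a locally consistent choice of generators of the local homology groups
  \<open>H\<^sub>2(M, M - {x})\<close> of the manifold without boundary \<open>M = surface_interior X\<close>.
\<close>

definition orientable_surface :: "'a topology \<Rightarrow> bool" where
  "orientable_surface X \<longleftrightarrow>
     (let M = surface_interior X; Y = subtopology X M in
      \<exists>or. (\<forall>x \<in> M. or x \<in> carrier (relative_homology_group 2 Y (M - {x})) \<and>
               subgroup_generated (relative_homology_group 2 Y (M - {x})) {or x}
                 = relative_homology_group 2 Y (M - {x})) \<and>
           (\<forall>x \<in> M. \<exists>U. openin Y U \<and> x \<in> U \<and>
               (\<exists>c \<in> carrier (relative_homology_group 2 Y (M - U)).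
                  \<forall>y \<in> U. hom_induced 2 Y (M - U) Y (M - {y}) id c = or y)))"

abbreviation circle :: "complex topology" where
  "circle \<equiv> top_of_set (sphere 0 1)"

definition simple_closed_curve :: "'a topology \<Rightarrow> 'a set \<Rightarrow> bool" where
  "simple_closed_curve X C \<longleftrightarrow> (\<exists>\<gamma>. embedding_map circle X \<gamma> \<and> C = \<gamma> ` topspace circle)"

definition nonseparating_family :: "'a topology \<Rightarrow> 'a set set \<Rightarrow> bool" where
  "nonseparating_family X \<C> \<longleftrightarrow> finite \<C> \<and> disjoint \<C> \<and>
     (\<forall>C \<in> \<C>. simple_closed_curve X C \<and> C \<subseteq> surface_interior X) \<and>
     connectedin X (topspace X - \<Union>\<C>)"

text \<open>
  The genus is the maximal number of pairwise disjoint simple closed curves in the interior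
  along which the surface can be cut without becoming disconnected.
\<close>

definition has_genus :: "'a topology \<Rightarrow> nat \<Rightarrow> bool" where
  "has_genus X g \<longleftrightarrow> (\<exists>\<C>. nonseparating_family X \<C> \<and> card \<C> = g) \<and>
     (\<forall>\<C>. nonseparating_family X \<C> \<longrightarrow> card \<C> \<le> g)"

definition compact_surface_of_type :: "'a topology \<Rightarrow> nat \<Rightarrow> nat \<Rightarrow> bool" where
  "compact_surface_of_type X g n \<longleftrightarrow>
     surface X \<and> topspace X \<noteq> {} \<and> compact_space X \<and> connected_space X \<and> orientable_surface X \<and>
     has_genus X g \<and> finite (boundary_components X) \<and> card (boundary_components X) = n"

definition complexity :: "nat \<Rightarrow> nat \<Rightarrow> int" where
  "complexity g n = 3 * int g + int n - 3"

text \<open>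
  A curve is the image of an embedded circle, so it carries neither a parametrisation nor a
  direction. A free isotopy is a homotopy through embeddings.
\<close>

definition isotopic_curves :: "'a topology \<Rightarrow> 'a set \<Rightarrow> 'a set \<Rightarrow> bool" where
  "isotopic_curves X C D \<longleftrightarrow>
     (\<exists>\<gamma> \<delta>. homotopic_with (embedding_map circle X) circle X \<gamma> \<delta> \<and>
        C = \<gamma> ` topspace circle \<and> D = \<delta> ` topspace circle)"

definition inessential_curve :: "'a topology \<Rightarrow> 'a set \<Rightarrow> bool" where
  "inessential_curve X C \<longleftrightarrow>
     (\<exists>\<gamma> c. embedding_map circle X \<gamma> \<and> C = \<gamma> ` topspace circle \<and>
        homotopic_with (\<lambda>_. True) circle X \<gamma> (\<lambda>_. c))"

definition curves :: "'a topology \<Rightarrow> 'a set set" where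
  "curves X = {C. simple_closed_curve X C \<and> \<not> inessential_curve X C \<and>
     (\<forall>B \<in> boundary_components X. \<not> isotopic_curves X C B)}"

definition isotopy_rel :: "'a topology \<Rightarrow> 'a set rel" where
  "isotopy_rel X = {(C, D). C \<in> curves X \<and> D \<in> curves X \<and> isotopic_curves X C D}"

definition curve_graph :: "'a topology \<Rightarrow> 'a set set pair_pre_digraph" where
  "curve_graph X =
     \<lparr>pverts = curves X // isotopy_rel X,
      parcs = {(a, b). a \<in> curves X // isotopy_rel X \<and> b \<in> curves X // isotopy_rel X \<and> a \<noteq> b \<and>
                (\<exists>C \<in> a. \<exists>D \<in> b. C \<inter> D = {})}\<rparr>"

lemma wf_digraph_curve_graph: "wf_digraph (with_proj (curve_graph X))"
  by (rule wf_digraph.intro) (auto simp: curve_graph_def)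

definition curve_dist :: "'a topology \<Rightarrow> 'a set set \<Rightarrow> 'a set set \<Rightarrow> ereal" where
  "curve_dist X = wf_digraph.\<mu> (with_proj (curve_graph X)) (\<lambda>_. 1)"

text \<open>Restricted to finite intersections because \<open>card\<close> of an infinite set is \<open>0\<close>.\<close>

definition geom_int :: "'a set set \<Rightarrow> 'a set set \<Rightarrow> nat" where
  "geom_int a b = (LEAST k. \<exists>C \<in> a. \<exists>D \<in> b. finite (C \<inter> D) \<and> card (C \<inter> D) = k)"

text \<open>
  A geodesic is given by its list of vertices \<open>v ! 0, \<dots>, v ! d\<close>, where
  \<open>d = vwalk_length v = length v - 1\<close>.
\<close>

definition curve_geodesic :: "'a topology \<Rightarrow> 'a set set \<Rightarrow> 'a set set list \<Rightarrow> 'a set set \<Rightarrow> bool" where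
  "curve_geodesic X x v y \<longleftrightarrow> vwalk v (with_proj (curve_graph X)) \<and> hd v = x \<and> last v = y \<and>
     curve_dist X x y = ereal (real (vwalk_length v))"

text \<open>
  The two factors \<open>i(x, v\<^sub>p)\<close> and \<open>i(v\<^sub>p, y)\<close> for the \<open>p\<close>-th vertex of a geodesic \<open>v\<close> from \<open>x\<close>
  to \<open>y\<close>, with the convention that they are \<open>1\<close> (instead of \<open>0\<close>) when \<open>v\<^sub>p\<close> is the neighbour
  of the respective endpoint.
\<close>

definition int_start :: "'a set set list \<Rightarrow> nat \<Rightarrow> nat" where
  "int_start v p = (if p = 1 then 1 else geom_int (hd v) (v ! p))"

definition int_end :: "'a set set list \<Rightarrow> nat \<Rightarrow> nat" where
  "int_end v p = (if p + 1 = vwalk_length v then 1 else geom_int (v ! p) (last v))"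

text \<open>
  The indices \<open>p\<close> and \<open>q\<close> range over the vertices strictly between \<open>x\<close> and \<open>y\<close>: at an endpoint
  the right-hand side would vanish because of \<open>i(x, x) = 0\<close>. So the property only concerns
  geodesics of length at least \<open>5\<close>.
\<close>

definition property_star :: "'a topology \<Rightarrow> real \<Rightarrow> bool" where
  "property_star X V \<longleftrightarrow>
     (\<forall>x \<in> pverts (curve_graph X). \<forall>y \<in> pverts (curve_graph X). \<forall>v.
        curve_geodesic X x v y \<and> (\<forall>i < length v. curve_dist X x (v ! i) = ereal (real i)) \<longrightarrow>
        (\<forall>p q. 0 < p \<and> p < vwalk_length v \<and> 0 < q \<and> q < vwalk_length v \<and>
               \<bar>int p - int q\<bar> > 2 \<longrightarrow>
           real (geom_int x y) \<le>
             real (int_start v p * int_end v p * int_start v q * int_end v q) powr V))"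

end

theory Submission
  imports Defs
begin

text \<open>
  Write \<open>I\<close> for \<open>i(x, y)\<close> and \<open>a\<^sub>p\<close> for the product \<open>i(x, v\<^sub>p) \<cdot> i(v\<^sub>p, y)\<close>, and call \<open>p\<close> bad if the
  bound \<open>I \<le> a\<^sub>p\<^bsup>2V\<^esup>\<close> fails. Property \<open>(\<ast>)\<close> says that \<open>I\<close> is at most \<open>a\<^sub>p\<^bsup>V\<^esup> \<cdot> a\<^sub>q\<^bsup>V\<^esup>\<close>, the geometric
  mean of the two bounds \<open>a\<^sub>p\<^bsup>2V\<^esup>\<close> and \<open>a\<^sub>q\<^bsup>2V\<^esup>\<close>, as soon as \<open>p\<close> and \<open>q\<close> differ by more than \<open>2\<close>.
  A number that is at most a geometric mean is at most one of the two numbers, so two bad indices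
  differ by at most \<open>2\<close> (\<open>le_powr_double_cases\<close>). Hence all bad indices lie within \<open>2\<close> of the
  smallest one (\<open>close_indices_in_window\<close>), and this window is the exceptional set.
\<close>

text \<open>
  If both inequalities failed, then \<open>c\<^sup>2\<close> would exceed \<open>a\<^bsup>2V\<^esup> \<cdot> b\<^bsup>2V\<^esup>\<close>, which is the square of the
  given bound. Bounding \<open>a \<cdot> b\<close> by the square of the larger factor would only work for \<open>V \<ge> 0\<close>.
\<close>

lemma le_powr_double_cases:
  fixes a b c V :: real
  assumes "0 \<le> a" "0 \<le> b" and bound: "c \<le> (a * b) powr V"
  shows "c \<le> a powr (2 * V) \<or> c \<le> b powr (2 * V)"
proof (rule ccontr)
  assume "\<not> ?thesis"
  then have gt: "a powr (2 * V) < c" "b powr (2 * V) < c" by auto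
  then have "0 < c" using powr_ge_zero[of a "2 * V"] by linarith
  have double: "t powr (2 * V) = t powr V * t powr V" for t :: real
    by (metis mult_2 powr_add)
  have "((a * b) powr V)\<^sup>2 = a powr (2 * V) * b powr (2 * V)"
    using assms(1,2) by (simp add: double powr_mult power2_eq_square)
  also have "\<dots> < c * c"
    using gt by (intro mult_strict_mono') auto
  also have "\<dots> \<le> ((a * b) powr V)\<^sup>2"
    using bound \<open>0 < c\<close> by (simp add: power2_eq_square mult_mono)
  finally show False by simp
qed

lemma close_indices_in_window:
  fixes P :: "nat \<Rightarrow> bool"
  assumes close: "\<And>p q. P p \<Longrightarrow> P q \<Longrightarrow> \<bar>int p - int q\<bar> \<le> int d"
  shows "\<exists>k. \<forall>p. P p \<longrightarrow> p \<in> {k..k + d}"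
proof (cases "\<exists>p. P p")
  case True
  then have "P (LEAST p. P p)" by (rule LeastI_ex)
  moreover have "(LEAST p. P p) \<le> p" if "P p" for p using that by (rule Least_le)
  ultimately show ?thesis using close by (intro exI[of _ "LEAST p. P p"]) fastforce
qed auto

theorem corollary1p7:
  fixes S :: "'a topology" and g n :: nat and V :: real
    and x y :: "'a set set" and v :: "'a set set list"
  assumes "compact_surface_of_type S g n"
    and "complexity g n > 1"
    and "property_star S V"
    and "x \<in> pverts (curve_graph S)"
    and "y \<in> pverts (curve_graph S)"
    and "curve_geodesic S x v y"
    and "\<forall>i < length v. curve_dist S x (v ! i) = ereal (real i)"
  shows "\<exists>k. \<forall>p. 0 < p \<and> p < vwalk_length v \<and> p \<notin> {k..k + 2} \<longrightarrow>
           real (geom_int x y) \<le> real (int_start v p * int_end v p) powr (2 * V)"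
proof -
  define a where "a p = int_start v p * int_end v p" for p
  define bad where "bad p \<longleftrightarrow> 0 < p \<and> p < vwalk_length v \<and>
    \<not> real (geom_int x y) \<le> real (a p) powr (2 * V)" for p
  have "\<bar>int p - int q\<bar> \<le> int 2" if "bad p" "bad q" for p q
  proof (rule ccontr)
    assume far: "\<not> ?thesis"
    have "real (geom_int x y) \<le>
        real (int_start v p * int_end v p * int_start v q * int_end v q) powr V"
      using assms(3-7) that far unfolding property_star_def bad_def by simp
    then have "real (geom_int x y) \<le> (real (a p) * real (a q)) powr V"
      by (simp add: a_def mult.assoc)
    from le_powr_double_cases[OF _ _ this] that show False
      by (auto simp: bad_def)
  qed
  from close_indices_in_window[of bad, OF this] show ?thesis
    unfolding bad_def a_def by blast
qed

end
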